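(* Let $R_3$ be the dihedral quandle of order $3$. Then: (1) $R_3$ is not a subquandle of $M_{\lambda_1,\lambda_2}$ for any $\lambda_1,\lambda_2\in\mathbb{C}^*$ with $\lambda_1\neq\pm\lambda_2$ (that is, no subquandle of $M_{\lambda_1,\lambda_2}$ is isomorphic to $R_3$); (2) $R_3$ is not a subquandle of $M_\lambda$ for any $\lambda\in\mathbb{C}^*$ (that is, no subquandle of $M_\lambda$ is isomorphic to $R_3$).
   Context: A quandle is a non-empty set $Q$ with a binary operation $*$ such that: (Q1) $x*x=x$ for all $x$; (Q2) for all $x,y\in Q$ there is a unique $z\in Q$ with $x=z*y$; (Q3) $(x*y)*z=(x*z)*(y*z)$ for all $x,y,z$. A subquandle is a subset that is a quandle under the same operation. A quandle isomorphism is a bijection $\phi$ with $\phi(x*y)=\phi(x)*\phi(y)$. $R_3=\{0,1,2\}$ with $i*j=2j-i \bmod 3$. $M_{\lambda_1,\lambda_2}$ is the conjugacy class in $\operatorname{GL}(2,\mathbb{C})$ of $\begin{pmatrix}\lambda_1&0\\0&\lambda_2\end{pmatrix}$, and $M_\lambda$ that of $\begin{pmatrix}\lambda&1\\0&\lambda\end{pmatrix}$; both are regarded as quandles with operation $X*Y=Y^{-1}XY$. *)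

theory Defs
  imports "HOL-Analysis.Analysis"
begin

locale quandle =
  fixes Q :: "'a set" and op :: "'a \<Rightarrow> 'a \<Rightarrow> 'a"
  assumes nonempty: "Q \<noteq> {}"
    and closed: "\<lbrakk>x \<in> Q; y \<in> Q\<rbrakk> \<Longrightarrow> op x y \<in> Q"
    and idem: "x \<in> Q \<Longrightarrow> op x x = x"
    and right_div: "\<lbrakk>x \<in> Q; y \<in> Q\<rbrakk> \<Longrightarrow> \<exists>!z. z \<in> Q \<and> x = op z y"
    and distrib: "\<lbrakk>x \<in> Q; y \<in> Q; z \<in> Q\<rbrakk> \<Longrightarrow> op (op x y) z = op (op x z) (op y z)"

definition subquandle :: "'a set \<Rightarrow> 'a set \<Rightarrow> ('a \<Rightarrow> 'a \<Rightarrow> 'a) \<Rightarrow> bool" where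
  "subquandle S Q op \<longleftrightarrow> S \<subseteq> Q \<and> quandle S op"

definition quandle_iso ::
  "('a \<Rightarrow> 'b) \<Rightarrow> 'a set \<Rightarrow> ('a \<Rightarrow> 'a \<Rightarrow> 'a) \<Rightarrow> 'b set \<Rightarrow> ('b \<Rightarrow> 'b \<Rightarrow> 'b) \<Rightarrow> bool" where
  "quandle_iso \<phi> Q op Q' op' \<longleftrightarrow>
     bij_betw \<phi> Q Q' \<and> (\<forall>x\<in>Q. \<forall>y\<in>Q. \<phi> (op x y) = op' (\<phi> x) (\<phi> y))"

definition quandle_isomorphic ::
  "'a set \<Rightarrow> ('a \<Rightarrow> 'a \<Rightarrow> 'a) \<Rightarrow> 'b set \<Rightarrow> ('b \<Rightarrow> 'b \<Rightarrow> 'b) \<Rightarrow> bool" where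
  "quandle_isomorphic Q op Q' op' \<longleftrightarrow> (\<exists>\<phi>. quandle_iso \<phi> Q op Q' op')"

(* The operation is taken on int, so that 2 * j - i is not truncated. *)
definition R3 :: "int set" where
  "R3 = {0, 1, 2}"

definition R3_op :: "int \<Rightarrow> int \<Rightarrow> int" where
  "R3_op i j = (2 * j - i) mod 3"

definition GL2 :: "(complex^2^2) set" where
  "GL2 = {P. invertible P}"

definition conj_op :: "complex^2^2 \<Rightarrow> complex^2^2 \<Rightarrow> complex^2^2" where
  "conj_op X Y = matrix_inv Y ** X ** Y"

definition conj_class :: "complex^2^2 \<Rightarrow> (complex^2^2) set" where
  "conj_class A = {conj_op A P |P. P \<in> GL2}"

definition M_diag :: "complex \<Rightarrow> complex \<Rightarrow> (complex^2^2) set" where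
  "M_diag \<mu>1 \<mu>2 = conj_class (vector [vector [\<mu>1, 0], vector [0, \<mu>2]])"

definition M_jordan :: "complex \<Rightarrow> (complex^2^2) set" where
  "M_jordan \<mu> = conj_class (vector [vector [\<mu>, 1], vector [0, \<mu>]])"

lemma quandle_R3: "quandle R3 R3_op"
proof
  fix x y z
  assume "x \<in> R3" "y \<in> R3"
  then show "\<exists>!z. z \<in> R3 \<and> x = R3_op z y"
    by (intro ex1I[of _ "R3_op x y"]) (auto simp: R3_def R3_op_def)
qed (auto simp: R3_def R3_op_def)

lemma matrix_inv_GL2:
  assumes "P \<in> GL2"
  shows "matrix_inv P ** P = mat 1" "P ** matrix_inv P = mat 1" "matrix_inv P \<in> GL2"
proof -
  have "\<exists>B. P ** B = mat 1 \<and> B ** P = mat 1"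
    using assms by (simp add: GL2_def invertible_def)
  then have *: "P ** matrix_inv P = mat 1 \<and> matrix_inv P ** P = mat 1"
    unfolding matrix_inv_def by (rule someI_ex)
  then show "matrix_inv P ** P = mat 1" "P ** matrix_inv P = mat 1" by auto
  show "matrix_inv P \<in> GL2"
    using * unfolding GL2_def invertible_def by blast
qed

lemma matrix_inv_mult_GL2:
  assumes "P \<in> GL2" "R \<in> GL2"
  shows "matrix_inv (P ** R) = matrix_inv R ** matrix_inv P" "P ** R \<in> GL2"
proof -
  show "P ** R \<in> GL2" using assms by (simp add: GL2_def invertible_mult)
  then have "matrix_inv (P ** R) = matrix_inv (P ** R) ** (P ** (R ** matrix_inv R) ** matrix_inv P)"
    using assms by (simp add: matrix_inv_GL2)
  also have "\<dots> = (matrix_inv (P ** R) ** (P ** R)) ** (matrix_inv R ** matrix_inv P)"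
    by (simp add: matrix_mul_assoc)
  also have "\<dots> = matrix_inv R ** matrix_inv P"
    using \<open>P ** R \<in> GL2\<close> by (simp add: matrix_inv_GL2)
  finally show "matrix_inv (P ** R) = matrix_inv R ** matrix_inv P" .
qed

lemma conj_op_mult:
  assumes "P \<in> GL2" "R \<in> GL2"
  shows "conj_op (conj_op X P) R = conj_op X (P ** R)"
  using assms by (simp add: conj_op_def matrix_inv_mult_GL2 matrix_mul_assoc)

lemma conj_op_GL2:
  assumes "P \<in> GL2"
  shows "conj_op (conj_op X P) (matrix_inv P) = X" "conj_op (conj_op X (matrix_inv P)) P = X"
    and "X \<in> GL2 \<Longrightarrow> conj_op X P \<in> GL2"
proof -
  have "mat 1 \<in> GL2"
    by (auto simp: GL2_def invertible_def intro!: exI[of _ "mat 1"])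
  then have "conj_op X (mat 1) = X"
    using matrix_inv_GL2(1)[of "mat 1"] by (simp add: conj_op_def)
  then show "conj_op (conj_op X P) (matrix_inv P) = X" "conj_op (conj_op X (matrix_inv P)) P = X"
    using assms by (simp_all add: conj_op_mult matrix_inv_GL2)
  show "X \<in> GL2 \<Longrightarrow> conj_op X P \<in> GL2"
    using assms by (simp add: conj_op_def matrix_inv_GL2 matrix_inv_mult_GL2)
qed

lemma quandle_conj_class:
  assumes "A \<in> GL2"
  shows "quandle (conj_class A) conj_op"
proof
  have sub: "x \<in> GL2" if "x \<in> conj_class A" for x
    using that assms by (auto simp: conj_class_def conj_op_GL2)
  have cl: "conj_op x P \<in> conj_class A" if "x \<in> conj_class A" "P \<in> GL2" for x P
    using that matrix_inv_mult_GL2(2) by (fastforce simp: conj_class_def conj_op_mult)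
  show "conj_class A \<noteq> {}" using assms by (auto simp: conj_class_def)
  fix x y z
  assume x: "x \<in> conj_class A"
  show "conj_op x x = x"
    using sub[OF x] by (simp add: conj_op_def matrix_inv_GL2)
  assume y: "y \<in> conj_class A"
  show "conj_op x y \<in> conj_class A" using cl x sub[OF y] by blast
  show "\<exists>!z. z \<in> conj_class A \<and> x = conj_op z y"
    using x cl[OF x matrix_inv_GL2(3)[OF sub[OF y]]] sub[OF y]
    by (intro ex1I[of _ "conj_op x (matrix_inv y)"]) (auto simp: conj_op_GL2)
  assume z: "z \<in> conj_class A"
  have "y ** z = z ** conj_op y z"
    using sub[OF z] by (simp add: conj_op_def matrix_mul_assoc matrix_inv_GL2)
  then show "conj_op (conj_op x y) z = conj_op (conj_op x z) (conj_op y z)"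
    using sub[OF y] sub[OF z] by (simp add: conj_op_GL2 conj_op_mult)
qed

lemma representatives_GL2:
  "\<mu>1 \<noteq> 0 \<Longrightarrow> \<mu>2 \<noteq> 0 \<Longrightarrow> vector [vector [\<mu>1, 0], vector [0, \<mu>2]] \<in> GL2"
  "\<mu> \<noteq> 0 \<Longrightarrow> vector [vector [\<mu>, 1], vector [0, \<mu>]] \<in> GL2"
  by (simp_all add: GL2_def invertible_det_nz det_2)

end

theory Submission
  imports Defs
begin

text \<open>
  In \<^const>\<open>R3\<close> every right translation is an involution without being the identity, and this is
  what a conjugacy class with non-zero trace cannot imitate. Suppose \<open>Y\<close> acts on \<open>X\<close> by
  conjugation and acting twice returns \<open>X\<close>; then \<open>X\<close> commutes with \<open>Y\<^sup>2\<close>. By Cayley--Hamilton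
  \<open>Y\<^sup>2 = tY - d\<close>, where \<open>t\<close> and \<open>d\<close> are the trace and determinant of \<open>Y\<close>, so as soon as \<open>t \<noteq> 0\<close>
  the matrix \<open>Y\<close> is a linear combination of \<open>Y\<^sup>2\<close> and the identity, and \<open>X\<close> already commutes
  with \<open>Y\<close> (\<open>commute_if_commute_square\<close>). Hence \<open>Y\<close> fixes \<open>X\<close>, whereas in \<^const>\<open>R3\<close> the element
  \<open>1\<close> moves \<open>0\<close> to \<open>2\<close>. The trace is constant on a conjugacy class; it is \<open>\<mu>1 + \<mu>2\<close> in the
  diagonalisable case and \<open>2\<mu>\<close> in the Jordan case, so both parts are instances of
  \<open>no_R3_in_conj_class\<close>.
\<close>

lemma mat_commute:
  fixes X :: "'a::comm_ring_1^'n^'n"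
  shows "mat c ** X = X ** mat c"
  by (simp add: vec_eq_iff matrix_matrix_mult_def mat_def if_distrib if_distribR mult.commute
      cong: if_cong)

lemma matrix_add_rdistrib:
  fixes A B :: "'a::semiring_1^'n^'m"
  shows "(A + B) ** C = A ** C + B ** C"
  by (simp add: vec_eq_iff matrix_matrix_mult_def distrib_right sum.distrib)

lemma cayley_hamilton_2:
  fixes Y :: "'a::comm_ring_1^2^2"
  shows "Y ** Y = mat (trace Y) ** Y - mat (det Y)"
  by (simp add: vec_eq_iff forall_2 matrix_matrix_mult_def mat_def sum_2 trace_def det_2
      algebra_simps)

text \<open>
  If the trace vanishes then \<open>Y\<^sup>2\<close> is scalar and commutes with everything, so the trace hypothesis
  is what makes \<open>Y\<close> recoverable from \<open>Y\<^sup>2\<close>.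
\<close>

lemma commute_if_commute_square:
  fixes X Y :: "'a::field^2^2"
  assumes "trace Y \<noteq> 0" and comm: "X ** (Y ** Y) = (Y ** Y) ** X"
  shows "X ** Y = Y ** X"
proof -
  let ?t = "trace Y" and ?d = "det Y"
  have cancel: "mat (inverse ?t) ** (mat ?t ** Z) = Z" for Z :: "'a^2^2"
    using \<open>trace Y \<noteq> 0\<close>
    by (simp add: vec_eq_iff forall_2 matrix_matrix_mult_def mat_def sum_2)
  have "mat ?t ** (X ** Y) = X ** (mat ?t ** Y)"
    by (metis mat_commute matrix_mul_assoc)
  also have "\<dots> = X ** (Y ** Y) + X ** mat ?d"
    by (simp add: cayley_hamilton_2 flip: matrix_add_ldistrib)
  also have "\<dots> = (Y ** Y + mat ?d) ** X"
    by (simp add: comm mat_commute matrix_add_rdistrib)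
  also have "\<dots> = mat ?t ** (Y ** X)"
    by (simp add: cayley_hamilton_2 flip: matrix_mul_assoc)
  finally show ?thesis by (metis cancel)
qed

lemma conj_op_fixed_iff_commute:
  assumes "P \<in> GL2"
  shows "conj_op X P = X \<longleftrightarrow> X ** P = P ** X"
proof
  assume "conj_op X P = X"
  then have "P ** X = P ** (matrix_inv P ** X ** P)"
    by (simp add: conj_op_def)
  also have "\<dots> = X ** P"
    using assms by (simp add: matrix_mul_assoc matrix_inv_GL2)
  finally show "X ** P = P ** X" by simp
next
  assume "X ** P = P ** X"
  then have "conj_op X P = matrix_inv P ** (P ** X)"
    by (simp add: conj_op_def flip: matrix_mul_assoc)
  then show "conj_op X P = X"
    using assms by (simp add: matrix_mul_assoc matrix_inv_GL2)
qed

lemma trace_conj_op: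
  assumes "P \<in> GL2"
  shows "trace (conj_op X P) = trace X"
proof -
  have "trace (conj_op X P) = trace (P ** (matrix_inv P ** X))"
    unfolding conj_op_def by (rule trace_mul_sym)
  then show ?thesis
    using assms by (simp add: matrix_mul_assoc matrix_inv_GL2)
qed

lemma conj_op_involution_trivial:
  assumes "Y \<in> GL2" "trace Y \<noteq> 0" "conj_op (conj_op X Y) Y = X"
  shows "conj_op X Y = X"
proof -
  have "X ** (Y ** Y) = (Y ** Y) ** X"
    using assms by (simp add: conj_op_mult matrix_inv_mult_GL2 flip: conj_op_fixed_iff_commute)
  then show ?thesis
    using assms commute_if_commute_square by (simp add: conj_op_fixed_iff_commute)
qed

lemma no_R3_in_conj_class:
  assumes "A \<in> GL2" "trace A \<noteq> 0"
    and "subquandle S (conj_class A) conj_op"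
  shows "\<not> quandle_isomorphic S conj_op R3 R3_op"
proof
  assume "quandle_isomorphic S conj_op R3 R3_op"
  then obtain \<phi> where bij: "bij_betw \<phi> S R3"
    and hom: "\<And>x y. x \<in> S \<Longrightarrow> y \<in> S \<Longrightarrow> \<phi> (conj_op x y) = R3_op (\<phi> x) (\<phi> y)"
    by (auto simp: quandle_isomorphic_def quandle_iso_def)
  interpret S: quandle S conj_op
    using assms(3) by (simp add: subquandle_def)
  have "0 \<in> \<phi> ` S" "1 \<in> \<phi> ` S"
    using bij by (auto simp: bij_betw_def R3_def)
  then obtain X Y where X: "X \<in> S" "\<phi> X = 0" and Y: "Y \<in> S" "\<phi> Y = 1"
    by (metis imageE)
  have "Y \<in> conj_class A"
    using Y assms(3) by (auto simp: subquandle_def)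
  then have "Y \<in> GL2" "trace Y \<noteq> 0"
    using assms(1,2) by (auto simp: conj_class_def conj_op_GL2 trace_conj_op)
  moreover have "conj_op (conj_op X Y) Y = X"
  proof (rule inj_onD[OF bij_betw_imp_inj_on[OF bij]])
    show "\<phi> (conj_op (conj_op X Y) Y) = \<phi> X"
      using X Y by (simp add: hom S.closed R3_op_def)
  qed (use X Y S.closed in auto)
  ultimately have "conj_op X Y = X"
    by (rule conj_op_involution_trivial)
  then have "R3_op 0 1 = 0"
    using hom[OF X(1) Y(1)] X Y by simp
  then show False by (simp add: R3_op_def)
qed

theorem theorem6p10:
  shows "(\<forall>\<mu>1 \<mu>2 :: complex. \<mu>1 \<noteq> 0 \<and> \<mu>2 \<noteq> 0 \<and> \<mu>1 \<noteq> \<mu>2 \<and> \<mu>1 \<noteq> - \<mu>2 \<longrightarrow>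
            \<not> (\<exists>S. subquandle S (M_diag \<mu>1 \<mu>2) conj_op \<and> quandle_isomorphic S conj_op R3 R3_op))
       \<and> (\<forall>\<mu> :: complex. \<mu> \<noteq> 0 \<longrightarrow>
            \<not> (\<exists>S. subquandle S (M_jordan \<mu>) conj_op \<and> quandle_isomorphic S conj_op R3 R3_op))"
proof (intro conjI allI impI notI; elim exE conjE)
  fix \<mu>1 \<mu>2 :: complex and S
  let ?D = "vector [vector [\<mu>1, 0], vector [0, \<mu>2]] :: complex^2^2"
  assume "\<mu>1 \<noteq> 0" "\<mu>2 \<noteq> 0" "\<mu>1 \<noteq> - \<mu>2"
  then have "?D \<in> GL2" "trace ?D \<noteq> 0"
    by (simp_all add: representatives_GL2 trace_def sum_2 add_eq_0_iff2)
  moreover assume "subquandle S (M_diag \<mu>1 \<mu>2) conj_op" "quandle_isomorphic S conj_op R3 R3_op"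
  ultimately show False
    using no_R3_in_conj_class unfolding M_diag_def by blast
next
  fix \<mu> :: complex and S
  let ?J = "vector [vector [\<mu>, 1], vector [0, \<mu>]] :: complex^2^2"
  assume "\<mu> \<noteq> 0"
  then have "?J \<in> GL2" "trace ?J \<noteq> 0"
    by (simp_all add: representatives_GL2 trace_def sum_2)
  moreover assume "subquandle S (M_jordan \<mu>) conj_op" "quandle_isomorphic S conj_op R3 R3_op"
  ultimately show False
    using no_R3_in_conj_class unfolding M_jordan_def by blast
qed

end
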